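(* Let $f:S^1\to S^2$ be a continuous map, and let $I\subset S^1$ be the set of injective points, i.e. the points $x\in S^1$ with $f^{-1}(f(x))=\{x\}$. Suppose $I$ contains an open subset $U$ of $S^1$, let $q\in U$, and put $p:=f(q)$. Then: 1. $f(S^1)$ separates $S^2$, i.e. $S^2-f(S^1)$ is disconnected; write it as the disjoint union $\coprod U_i$ of its connected components, each of which is open; 2. there are precisely two components $U_1,U_2$ of $S^2-f(S^1)$ which contain $p$ in their closure; 3. if $F:\mathbb{D}^2\to S^2$ is a continuous extension of $f$ to the closed disk $\mathbb{D}^2$ (with $\partial\mathbb{D}^2=S^1$), then $F(\mathbb{D}^2)\supseteq U_1$ or $F(\mathbb{D}^2)\supseteq U_2$. *)

theory Defs
  imports "HOL-Analysis.Analysis"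
begin

abbreviation S1 :: "complex set"
  where "S1 \<equiv> sphere 0 1"

abbreviation D2 :: "complex set"
  where "D2 \<equiv> cball 0 1"

abbreviation S2 :: "(real ^ 3) set"
  where "S2 \<equiv> sphere 0 1"

text \<open>The domain is restricted to \<open>S1\<close> explicitly, because \<open>f\<close> is a total function on
  \<^typ>\<open>complex\<close> whose values outside \<open>S1\<close> are irrelevant.\<close>

definition injective_points :: "(complex \<Rightarrow> real ^ 3) \<Rightarrow> complex set"
  where "injective_points f = {x \<in> S1. S1 \<inter> f -` {f x} = {x}}"

end

theory Submission
  imports Defs "HOL-Complex_Analysis.Complex_Analysis"
begin

text \<open>
  Stereographic projection from a point off the curve turns \<open>f\<close> into a planar loop. A short
  arc of it around the simple point, completed by an arc inside the compact path \<open>K\<close>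
  traced by the rest of the loop, is a Jordan curve \<open>j\<close>. The winding numbers of the loop and of
  \<open>j\<close> differ by that of a loop in \<open>K\<close>, which is constant near the simple point, so the winding
  number of \<open>f\<close> jumps there; and since \<open>j \<inter> K\<close> is connected, Janiszewski's theorem shows that
  near the point each side of \<open>j\<close> lies in one component of the complement of the curve. If an
  extension \<open>F\<close> to the disc missed a point on each of the two sides, projecting from one of
  them would give both sides winding number 0: one because it contains the point at infinity,
  the other because \<open>F\<close> contracts the loop in its complement.
\<close>

section \<open>The two sides of a planar loop at a simple point\<close>

text \<open>\<open>I\<close> and \<open>J\<close> are the parts of a small disc \<open>N\<close>
  inside and outside the Jordan curve \<open>j\<close>. Each may fall into many pieces, so
  connectedness is claimed only in the whole complement of the loop, where pieces on the same side
  are joined, possibly by leaving \<open>N\<close>. The inequality of winding numbers keeps the two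
  sides apart.\<close>

lemma loop_winding_number_jump:
  fixes g :: "real \<Rightarrow> complex"
  assumes g: "path g" "pathfinish g = pathstart g"
    and abc: "0 < a" "a < c" "c < b" "b < 1"
    and inj: "\<And>s t. \<lbrakk>s \<in> {a..b}; t \<in> {0..1}; g s = g t\<rbrakk> \<Longrightarrow> s = t"
  obtains N I J where "open N" "g c \<in> N" "N - path_image g = I \<union> J"
    "g c \<in> closure I" "g c \<in> closure J"
    "\<And>x y. \<lbrakk>x \<in> I; y \<in> I\<rbrakk> \<Longrightarrow> connected_component (- path_image g) x y"
    "\<And>x y. \<lbrakk>x \<in> J; y \<in> J\<rbrakk> \<Longrightarrow> connected_component (- path_image g) x y"
    "\<And>x y. \<lbrakk>x \<in> I; y \<in> J\<rbrakk> \<Longrightarrow> winding_number g x \<noteq> winding_number g y"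
proof -
  define \<alpha> where "\<alpha> = subpath a b g"
  \<comment> \<open>The rest of the loop, run from \<open>g b\<close> to \<open>g a\<close> through
    the base point \<open>g 1 = g 0\<close>; it may cross itself arbitrarily.\<close>
  define \<kappa> where "\<kappa> = subpath b 1 g +++ subpath 0 a g"
  define K where "K = path_image \<kappa>"
  have ends: "pathstart \<alpha> = g a" "pathfinish \<alpha> = g b" "pathstart \<kappa> = g b" "pathfinish \<kappa> = g a"
    by (auto simp: \<alpha>_def \<kappa>_def)
  have join: "pathfinish (subpath b 1 g) = pathstart (subpath 0 a g)"
    using g(2) by (simp add: pathfinish_def pathstart_def subpath_def)
  have \<alpha>: "arc \<alpha>" "path \<alpha>" and im\<alpha>: "path_image \<alpha> = g ` {a..b}"
  proof -
    show "path \<alpha>"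
      using abc g unfolding \<alpha>_def by (intro path_subpath) auto
    show "path_image \<alpha> = g ` {a..b}"
      using abc by (simp add: \<alpha>_def path_image_subpath)
    show "arc \<alpha>"
      unfolding \<alpha>_def
      by (rule arc_subpath_eq [THEN iffD2])
         (use abc g inj \<open>path \<alpha>\<close> in \<open>auto simp: inj_on_def \<alpha>_def closed_segment_eq_real_ivl\<close>)
  qed
  have "path \<kappa>" 
    unfolding \<kappa>_def using abc g join by (intro path_join_imp path_subpath) auto
  have K: "K = g ` {b..1} \<union> g ` {0..a}"
    using abc join by (simp add: K_def \<kappa>_def path_image_join path_image_subpath)
  have cK: "compact K"
    using \<open>path \<kappa>\<close> K_def by auto
  have X: "path_image g = path_image \<alpha> \<union> K"
  proof -
    have "{0..1} = {a..b} \<union> ({b..1} \<union> {0..a})"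
      using abc by auto
    then show ?thesis
      by (simp only: path_image_def [of g] im\<alpha> K image_Un)
  qed
  have \<alpha>K: "path_image \<alpha> \<inter> K = {g a, g b}"
  proof
    show "path_image \<alpha> \<inter> K \<subseteq> {g a, g b}"
    proof
      fix x assume x: "x \<in> path_image \<alpha> \<inter> K"
      then obtain s t where st: "s \<in> {a..b}" "x = g s" "t \<in> {b..1} \<union> {0..a}" "x = g t"
        unfolding im\<alpha> K by blast
      then have "s = t"
        using inj abc by auto
      then show "x \<in> {g a, g b}"
        using st by auto
    qed
  qed (use abc in \<open>auto simp: im\<alpha> K\<close>)
  have "g a \<noteq> g b"
    using inj [of a b] abc by auto
  \<comment> \<open>\<open>\<kappa>\<close> may be far from injective, so the closing arc is
    extracted from its image; this needs the two ends to be distinct.\<close>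
  then obtain \<beta> where \<beta>: "arc \<beta>" "path_image \<beta> \<subseteq> K" "pathstart \<beta> = g b" "pathfinish \<beta> = g a"
    using path_contains_arc [OF \<open>path \<kappa>\<close>] ends unfolding K_def by metis
  then have "path \<beta>"
    using arc_imp_path by blast
  define j where "j = \<alpha> +++ \<beta>"
  have j: "simple_path j" "pathfinish j = pathstart j"
  proof -
    show "simple_path j"
      unfolding j_def
      by (rule simple_path_join_loop) (use \<alpha> \<beta> ends \<alpha>K in auto)
    show "pathfinish j = pathstart j"
      by (simp add: j_def \<beta> ends)
  qed
  have imj: "path_image j = path_image \<alpha> \<union> path_image \<beta>"
    by (simp add: j_def path_image_join \<beta> ends)
  \<comment> \<open>\<open>\<alpha>\<close> touches \<open>K\<close> only at its ends, and these lie
    on \<open>\<beta>\<close>. So the intersection is an arc, which gives the connectedness that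
    Janiszewski's theorem asks for.\<close>
  have jK: "path_image j \<inter> K = path_image \<beta>"
  proof -
    have "{g a, g b} \<subseteq> path_image \<beta>"
      using \<beta> pathfinish_in_path_image pathstart_in_path_image by (metis empty_subsetI insert_subset)
    then show ?thesis
      using \<beta>(2) \<alpha>K unfolding imj by blast
  qed
  have Xj: "path_image g = path_image j \<union> K"
    using X imj \<beta>(2) by blast
  have pK: "g c \<notin> K"
  proof
    assume "g c \<in> K"
    then obtain t where "t \<in> {b..1} \<union> {0..a}" "g c = g t"
      unfolding K by blast
    then show False
      using inj [of c t] abc by auto
  qed
  have "open (- K)"
    using cK compact_imp_closed by blast
  then obtain \<epsilon> where "\<epsilon> > 0" and \<epsilon>: "ball (g c) \<epsilon> \<subseteq> - K"
    using pK open_contains_ball by (metis ComplI)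
  define N where "N = ball (g c) \<epsilon>"
  have NK: "N \<inter> K = {}"
    using \<epsilon> N_def by blast
  have pN: "g c \<in> N" "open N" "connected N"
    using \<open>\<epsilon> > 0\<close> by (auto simp: N_def)
  have pj: "g c \<in> path_image j"
    using abc by (auto simp: imj im\<alpha>)
  have frontiers: "frontier (inside (path_image j)) = path_image j" 
      "frontier (outside (path_image j)) = path_image j"
      "connected (inside (path_image j))" "connected (outside (path_image j))"
      "inside (path_image j) \<union> outside (path_image j) = - path_image j"
    using Jordan_inside_outside [OF j] by auto
  define I where "I = N \<inter> inside (path_image j)"
  define J where "J = N \<inter> outside (path_image j)"
  have cl: "g c \<in> closure (N \<inter> S)" if "g c \<in> frontier S" for S
    using that pN open_Int_closure_subset [of N S] by (auto simp: frontier_def)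
  \<comment> \<open>Neither of the two compact sets separates \<open>x\<close> from \<open>y\<close>
    on its own: \<open>S\<close> joins them off \<open>j\<close>, and the disc \<open>N\<close>
    joins them off \<open>K\<close>.\<close>
  have conn: "connected_component (- path_image g) x y"
    if "x \<in> N \<inter> S" "y \<in> N \<inter> S" "connected S" "S \<inter> path_image j = {}" for x y S
    unfolding Xj
  proof (rule Janiszewski)
    show "connected (path_image j \<inter> K)"
      by (simp add: jK \<open>path \<beta>\<close> connected_path_image)
    show "connected_component (- path_image j) x y"
      unfolding connected_component_def using that by blast
    show "connected_component (- K) x y"
      unfolding connected_component_def using that NK pN by blast
  qed (use cK j in \<open>auto simp: compact_imp_closed compact_simple_path_image\<close>)
  \<comment> \<open>Cutting \<open>g\<close> at \<open>a\<close> and \<open>b\<close> gives the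
    contributions of \<open>\<alpha>\<close> and \<open>\<kappa>\<close>. Adding and subtracting
    that of \<open>\<beta>\<close> regroups them into two closed loops, the second of which stays in
    \<open>K\<close>.\<close>
  have wind: "winding_number g x = winding_number j x + winding_number (\<kappa> +++ reversepath \<beta>) x"
    if "x \<notin> path_image g" for x
  proof -
    have x: "x \<notin> path_image \<alpha>" "x \<notin> path_image \<beta>" "x \<notin> K" "x \<notin> path_image (subpath b 1 g)"
        "x \<notin> path_image (subpath 0 a g)"
      using that X \<beta>(2) K abc by (auto simp: path_image_subpath)
    have "winding_number g x = winding_number (subpath 0 1 g) x"
      by simp
    also have "\<dots> = winding_number (subpath 0 a g) x + winding_number \<alpha> x + winding_number (subpath b 1 g) x"
      using abc g that by (simp add: winding_number_subpath_combine \<alpha>_def)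
    also have "winding_number (subpath 0 a g) x + winding_number \<alpha> x + winding_number (subpath b 1 g) x
        = winding_number \<alpha> x + winding_number \<kappa> x"
      unfolding \<kappa>_def using x join g abc by (subst winding_number_join) auto
    also have "winding_number \<alpha> x + winding_number \<kappa> x = winding_number j x + winding_number (\<kappa> +++ reversepath \<beta>) x"
      unfolding j_def using x \<alpha> \<beta> ends \<open>path \<beta>\<close> \<open>path \<kappa>\<close>
      by (simp add: winding_number_join winding_number_reversepath K_def)
    finally show ?thesis .
  qed
  \<comment> \<open>\<open>N\<close> is connected and misses \<open>K\<close>, so the second loop
    contributes equally on both sides and the jump comes from \<open>j\<close> alone.\<close>
  have "winding_number (\<kappa> +++ reversepath \<beta>) constant_on N"
  proof (rule winding_number_constant)
    show "N \<inter> path_image (\<kappa> +++ reversepath \<beta>) = {}"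
      using NK \<beta>(2) ends \<beta> by (auto simp: path_image_join K_def)
  qed (use \<open>path \<kappa>\<close> \<open>path \<beta>\<close> \<beta> ends pN in auto)
  then obtain w where w: "\<And>x. x \<in> N \<Longrightarrow> winding_number (\<kappa> +++ reversepath \<beta>) x = w"
    unfolding constant_on_def by blast
  have NX: "N - path_image g = I \<union> J"
    using frontiers(5) NK unfolding I_def J_def Xj by blast
  show ?thesis
  proof (rule that [of N I J])
    show "g c \<in> closure I" "g c \<in> closure J"
      using cl frontiers pj unfolding I_def J_def by auto
    show "connected_component (- path_image g) x y" if "x \<in> I" "y \<in> I" for x y
      using conn [of x "inside (path_image j)" y] that frontiers(3,5) unfolding I_def by blast
    show "connected_component (- path_image g) x y" if "x \<in> J" "y \<in> J" for x y
      using conn [of x "outside (path_image j)" y] that frontiers(4,5) unfolding J_def by blast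
    \<comment> \<open>A Jordan curve has winding number 1 or -1 about inside points and 0 about
      outside points.\<close>
    show "winding_number g x \<noteq> winding_number g y" if "x \<in> I" "y \<in> J" for x y
    proof -
      have "winding_number j y = 0"
        using that j by (auto simp: J_def simple_path_imp_path intro: winding_number_zero_in_outside)
      moreover have "winding_number j x \<noteq> 0"
        using simple_closed_path_winding_number_inside [OF j(1)] that unfolding I_def
        by (metis IntD2 zero_neq_one zero_neq_neg_one)
      moreover have "x \<in> N - path_image g" "y \<in> N - path_image g"
        using that NX by auto
      ultimately show ?thesis
        using wind [of x] wind [of y] w by auto
    qed
  qed (use pN NX in auto)
qed

section \<open>Stereographic projection and winding numbers\<close>

lemma stereographic_projection:
  fixes e :: "real ^ 3"
  assumes "e \<in> S2"
  obtains h k where "homeomorphism (S2 - {e}) (UNIV :: complex set) h k"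
proof -
  have "S2 - {e} homeomorphic (UNIV :: complex set)"
    using assms by (intro homeomorphic_punctured_sphere_affine) auto
  then show ?thesis
    using that unfolding homeomorphic_def by blast
qed

lemma open_stereographic_image:
  assumes hk: "homeomorphism (S2 - {e}) (UNIV :: complex set) h k"
    and V: "openin (top_of_set S2) V" "e \<notin> V"
  shows "open (h ` V)"
proof -
  have "V \<subseteq> S2 - {e}"
    using V openin_imp_subset by blast
  then have "openin (top_of_set (S2 - {e})) V"
    using V openin_subset_trans by blast
  then have "openin (top_of_set UNIV) (h ` V)"
    using homeomorphism_imp_open_map [OF hk] by blast
  then show ?thesis
    by simp
qed

lemma openin_inverse_stereographic_image:
  assumes hk: "homeomorphism (S2 - {e}) (UNIV :: complex set) h k" and N: "open N"
  shows "openin (top_of_set S2) (k ` N)"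
proof -
  have "openin (top_of_set (S2 - {e})) (k ` N)"
    using homeomorphism_imp_open_map [OF homeomorphism_symD [OF hk], of N] N
    by simp
  moreover have "openin (top_of_set S2) (S2 - {e})"
    by (simp add: openin_delete)
  ultimately show ?thesis
    using openin_trans by blast
qed

text \<open>Projection from a point outside \<open>V\<close> turns \<open>V\<close> into a connected
  open planar set, which stays connected when a point is deleted. This serves for a set containing
  the pole \<open>e\<close> of another projection, where that pole has to be left out.\<close>

lemma connected_delete_sphere:
  assumes V: "openin (top_of_set S2) V" "connected V" "V \<noteq> S2"
  shows "connected (V - {e})"
proof -
  have "V \<subseteq> S2"
    using V openin_imp_subset by blast
  then obtain s where s: "s \<in> S2" "s \<notin> V"
    using V by blast
  then obtain h k where hk: "homeomorphism (S2 - {s}) (UNIV :: complex set) h k"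
    using stereographic_projection by blast
  have kh: "k (h x) = x" if "x \<in> V" for x
    using that s \<open>V \<subseteq> S2\<close> by (intro homeomorphism_apply1 [OF hk]) blast
  have conth: "continuous_on V h"
    using \<open>V \<subseteq> S2\<close> s by (intro continuous_on_subset [OF homeomorphism_cont1 [OF hk]]) blast
  have "open (h ` V)" "connected (h ` V)"
    using open_stereographic_image [OF hk] V s conth by (auto intro: connected_continuous_image)
  then have "connected (h ` V - {h e})"
    by (intro connected_open_delete) auto
  moreover have "continuous_on (h ` V - {h e}) k"
    by (intro continuous_on_subset [OF homeomorphism_cont2 [OF hk]]) simp
  ultimately have "connected (k ` (h ` V - {h e}))"
    by (rule connected_continuous_image[rotated])
  moreover have "k ` (h ` V - {h e}) = V - {e}" if "e \<in> V"
  proof -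
    have "h x \<noteq> h e" if "x \<in> V" "x \<noteq> e" for x
      using kh [of x] kh [OF \<open>e \<in> V\<close>] that by auto
    then have "h ` V - {h e} = h ` (V - {e})"
      by auto
    moreover have "k ` h ` (V - {e}) = (\<lambda>x. x) ` (V - {e})"
      unfolding image_image using kh by (intro image_cong) auto
    ultimately show ?thesis
      by simp
  qed
  ultimately show ?thesis
    using V by (cases "e \<in> V") auto
qed

lemma path_stereographic:
  assumes "path \<gamma>" "pathfinish \<gamma> = pathstart \<gamma>" "path_image \<gamma> \<subseteq> S2 - {e}"
    and hk: "homeomorphism (S2 - {e}) (UNIV :: complex set) h k"
  shows "path (h \<circ> \<gamma>)" "pathfinish (h \<circ> \<gamma>) = pathstart (h \<circ> \<gamma>)"
proof -
  show "path (h \<circ> \<gamma>)"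
    using assms continuous_on_subset [OF homeomorphism_cont1 [OF hk]]
    by (intro path_continuous_image) auto
qed (simp add: assms pathfinish_compose pathstart_compose)

text \<open>\<open>V\<close> may contain the pole \<open>e\<close>. What remains after deleting it
  is still connected, and its projection misses the projected curve, so the winding number is
  constant there.\<close>

lemma winding_number_stereographic_eq:
  fixes \<gamma> :: "real \<Rightarrow> real ^ 3"
  assumes \<gamma>: "path \<gamma>" "pathfinish \<gamma> = pathstart \<gamma>" "path_image \<gamma> \<subseteq> S2 - {e}"
    and hk: "homeomorphism (S2 - {e}) (UNIV :: complex set) h k"
    and V: "openin (top_of_set S2) V" "connected V" "V \<inter> path_image \<gamma> = {}"
    and xy: "x \<in> V - {e}" "y \<in> V - {e}"
  shows "winding_number (h \<circ> \<gamma>) (h x) = winding_number (h \<circ> \<gamma>) (h y)"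
proof -
  have VS2: "V \<subseteq> S2"
    using V openin_imp_subset by blast
  have "V \<noteq> S2"
    using V \<gamma> path_image_nonempty by blast
  have "winding_number (h \<circ> \<gamma>) constant_on h ` (V - {e})"
  proof (rule winding_number_constant)
    show "connected (h ` (V - {e}))"
    proof (rule connected_continuous_image)
      show "continuous_on (V - {e}) h"
        using VS2 by (intro continuous_on_subset [OF homeomorphism_cont1 [OF hk]]) auto
    qed (use connected_delete_sphere V \<open>V \<noteq> S2\<close> in auto)
    have False if uv: "u \<in> V - {e}" "v \<in> path_image \<gamma>" "h u = h v" for u v
    proof -
      have "u \<in> S2 - {e}" "v \<in> S2 - {e}" "u \<noteq> v"
        using uv VS2 V \<gamma> by auto
      then show False
        using homeomorphism_apply1 [OF hk] uv by metis
    qed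
    then show "h ` (V - {e}) \<inter> path_image (h \<circ> \<gamma>) = {}"
      unfolding path_image_compose by blast
  qed (use path_stereographic [OF \<gamma> hk] in auto)
  then show ?thesis
    using xy unfolding constant_on_def by (metis imageI)
qed

text \<open>\<open>V\<close> is a neighbourhood of the pole, that is, of the point at infinity. So
  some points of \<open>V\<close> project far out, where the winding number vanishes, and constancy
  on \<open>V - {e}\<close> carries this value to \<open>x\<close>.\<close>

lemma winding_number_stereographic_eq_0:
  fixes \<gamma> :: "real \<Rightarrow> real ^ 3"
  assumes \<gamma>: "path \<gamma>" "pathfinish \<gamma> = pathstart \<gamma>" "path_image \<gamma> \<subseteq> S2 - {e}"
    and hk: "homeomorphism (S2 - {e}) (UNIV :: complex set) h k"
    and V: "openin (top_of_set S2) V" "connected V" "V \<inter> path_image \<gamma> = {}"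
    and e: "e \<in> V" and x: "x \<in> V - {e}"
  shows "winding_number (h \<circ> \<gamma>) (h x) = 0"
proof -
  have contk: "continuous_on UNIV k"
    using hk by (auto simp: homeomorphism_def)
  have eS2: "e \<in> S2"
    using e openin_imp_subset [OF V(1)] by blast
  have kh: "k (h x) = x" if "x \<in> S2" "x \<noteq> e" for x
    using hk that by (auto simp: homeomorphism_def)
  obtain B where B: "\<And>z. B \<le> norm z \<Longrightarrow> winding_number (h \<circ> \<gamma>) z = 0"
    using winding_number_zero_at_infinity [OF path_stereographic [OF \<gamma> hk]] by blast
  \<comment> \<open>Otherwise the compact image of \<open>cball 0 B\<close> under \<open>k\<close>
    contains \<open>V - {e}\<close> but not \<open>e\<close>. Then \<open>{e}\<close> is open and
    closed in the connected sphere, which the antipode \<open>- e\<close> refutes.\<close>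
  have "\<exists>y \<in> V - {e}. h y \<notin> cball 0 B"
  proof (rule ccontr)
    assume neg: "\<not> ?thesis"
    have "y \<in> k ` cball 0 B" if "y \<in> V - {e}" for y
    proof -
      have "h y \<in> cball 0 B"
        using neg that by blast
      moreover have "k (h y) = y"
        using that openin_imp_subset [OF V(1)] by (intro kh) blast+
      ultimately show ?thesis
        by (metis imageI)
    qed
    moreover have "e \<notin> k ` cball 0 B"
      using hk by (auto simp: homeomorphism_def)
    ultimately have "V - k ` cball 0 B = {e}"
      using e by blast
    moreover have "closed (k ` cball 0 B)"
      by (intro compact_imp_closed compact_continuous_image continuous_on_subset [OF contk]) auto
    then have "openin (top_of_set S2) (V - k ` cball 0 B)"
      using V(1) by (simp add: Diff_eq openin_Int_open open_Compl)
    ultimately have "openin (top_of_set S2) {e}"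
      by simp
    moreover have "closedin (top_of_set S2) {e}"
      using eS2 by (simp add: closed_subset)
    moreover have "connected S2"
      by (simp add: connected_sphere_eq)
    ultimately have "S2 = {e}"
      unfolding connected_clopen by blast
    moreover have "e \<noteq> 0"
      using eS2 by auto
    then have "- e \<in> S2" "- e \<noteq> e"
      using eS2 by (auto simp: vec_eq_iff)
    ultimately show False
      by blast
  qed
  then obtain y where y: "y \<in> V - {e}" "h y \<notin> cball 0 B"
    by blast
  then have "winding_number (h \<circ> \<gamma>) (h y) = 0"
    by (intro B) simp
  then show ?thesis
    using winding_number_stereographic_eq [OF \<gamma> hk V x y(1)] by simp
qed

text \<open>The loop \<open>c\<close> contracts in the disc. Since \<open>F\<close> misses the pole
  \<open>e\<close>, the contraction can be carried to the plane by \<open>h\<close>; since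
  \<open>F\<close> also misses \<open>u\<close>, the contraction never meets
  \<open>h u\<close>.\<close>

lemma winding_number_stereographic_disc:
  fixes F :: "complex \<Rightarrow> real ^ 3"
  assumes hk: "homeomorphism (S2 - {e}) (UNIV :: complex set) h k"
    and F: "continuous_on (cball 0 1) F" "F \<in> cball 0 1 \<rightarrow> S2 - {e, u}"
    and u: "u \<in> S2" "u \<noteq> e"
    and c: "path c" "pathfinish c = pathstart c" "path_image c \<subseteq> cball 0 1"
  shows "winding_number (h \<circ> (F \<circ> c)) (h u) = 0"
proof -
  have "simply_connected (cball 0 1 :: complex set)"
    by (simp add: convex_imp_simply_connected)
  then have "homotopic_loops (cball 0 1) c (linepath 0 0)"
    using c unfolding simply_connected_eq_contractible_loop_any by auto
  then have "homotopic_loops (- {h u}) ((h \<circ> F) \<circ> c) ((h \<circ> F) \<circ> linepath 0 0)"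
  proof (rule homotopic_loops_continuous_image)
    show "continuous_on (cball 0 1) (h \<circ> F)"
    proof (rule continuous_on_compose [OF F(1)])
      have "F ` cball 0 1 \<subseteq> S2 - {e}"
        using F(2) by blast
      then show "continuous_on (F ` cball 0 1) h"
        using continuous_on_subset [OF homeomorphism_cont1 [OF hk]] by blast
    qed
    have "h (F x) \<noteq> h u" if "x \<in> cball 0 1" for x
    proof
      assume "h (F x) = h u"
      moreover have Fx: "F x \<in> S2 - {e, u}"
        using F(2) that by blast
      ultimately have "F x = u"
        using homeomorphism_apply1 [OF hk, of u] homeomorphism_apply1 [OF hk, of "F x"] u by auto
      then show False
        using Fx by blast
    qed
    then show "h \<circ> F \<in> cball 0 1 \<rightarrow> - {h u}"
      by auto
  qed
  then have "winding_number ((h \<circ> F) \<circ> c) (h u) = winding_number ((h \<circ> F) \<circ> linepath 0 0) (h u)"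
      and ne: "h u \<notin> path_image ((h \<circ> F) \<circ> linepath 0 0)"
    using winding_number_homotopic_loops homotopic_loops_imp_subset by blast+
  moreover have "(h \<circ> F) \<circ> linepath 0 0 = (\<lambda>t. h (F 0))"
    by (auto simp: linepath_def)
  ultimately show ?thesis
    using ne by (auto simp: comp_assoc path_image_def winding_number_zero_const)
qed

section \<open>A path with an arc of simple points does not fill the sphere\<close>

text \<open>A path can fill the sphere, so the arc of simple points has to be used. Off the compact
  set \<open>K\<close> traced by the other parameters, a full sphere would be covered by an embedded
  arc. Inverting the arc would map a nonempty open planar set continuously and injectively into the
  line, against invariance of dimension.\<close>

lemma simple_point_path_image_neq_sphere:
  fixes \<gamma> :: "real \<Rightarrow> real ^ 3"
  assumes \<gamma>: "path \<gamma>" 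
    and abc: "0 < a" "a < c" "c < b" "b < 1"
    and inj: "\<And>s t. \<lbrakk>s \<in> {a..b}; t \<in> {0..1}; \<gamma> s = \<gamma> t\<rbrakk> \<Longrightarrow> s = t"
  shows "path_image \<gamma> \<noteq> S2"
proof
  assume S2: "path_image \<gamma> = S2"
  define K where "K = \<gamma> ` ({0..a} \<union> {b..1})"
  have cont: "continuous_on {0..1} \<gamma>"
    using \<gamma> path_def by blast
  have "compact K"
    unfolding K_def using abc by (intro compact_continuous_image continuous_on_subset [OF cont]) auto
  then have O: "openin (top_of_set S2) (S2 - K)"
    by (simp add: Diff_eq openin_open_Int open_Compl compact_imp_closed)
  \<comment> \<open>The pole \<open>\<gamma> a\<close> is taken in \<open>K\<close>, so that the
    projection is defined on all of \<open>S2 - K\<close>.\<close>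
  have aK: "\<gamma> a \<in> K" and "\<gamma> a \<in> S2"
    using abc S2 by (auto simp: K_def path_image_def)
  then obtain h k where hk: "homeomorphism (S2 - {\<gamma> a}) (UNIV :: complex set) h k"
    using stereographic_projection by blast
  have op: "open (h ` (S2 - K))"
    using open_stereographic_image [OF hk O] aK by blast
  have kh: "k (h x) = x" if "x \<in> S2 - K" for x
    using that aK by (intro homeomorphism_apply1 [OF hk]) blast
  have sub: "S2 - K \<subseteq> \<gamma> ` {a..b}"
  proof -
    have "{0..1} = {a..b} \<union> ({0..a} \<union> {b..1})"
      using abc by auto
    then show ?thesis
      using S2 unfolding K_def path_image_def by (metis Diff_subset_conv image_Un sup_commute order_refl)
  qed
  have inj': "inj_on \<gamma> {a..b}"
    using inj abc by (auto simp: inj_on_def)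
  \<comment> \<open>The parameter of a point of the arc; it depends continuously on the point
    because \<open>{a..b}\<close> is compact.\<close>
  define \<phi> where "\<phi> = inv_into {a..b} \<gamma>"
  have \<phi>: "continuous_on (\<gamma> ` {a..b}) \<phi>"
    unfolding \<phi>_def using inj' abc
    by (intro continuous_on_inv continuous_on_subset [OF cont]) auto
  have "continuous_on (h ` (S2 - K)) (\<phi> \<circ> k)"
  proof (rule continuous_on_compose)
    show "continuous_on (h ` (S2 - K)) k"
      by (intro continuous_on_subset [OF homeomorphism_cont2 [OF hk]]) simp
    have "k ` h ` (S2 - K) = S2 - K"
      unfolding image_image using kh by simp
    then show "continuous_on (k ` h ` (S2 - K)) \<phi>"
      using continuous_on_subset [OF \<phi> sub] by simp
  qed
  moreover have "inj_on (\<phi> \<circ> k) (h ` (S2 - K))"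
  proof (rule inj_onI; clarify)
    fix x y assume "x \<in> S2" "x \<notin> K" "y \<in> S2" "y \<notin> K" and eq: "(\<phi> \<circ> k) (h x) = (\<phi> \<circ> k) (h y)"
    then have "x \<in> \<gamma> ` {a..b}" "y \<in> \<gamma> ` {a..b}" "\<phi> x = \<phi> y"
      using sub kh by auto
    then show "h x = h y"
      unfolding \<phi>_def by (metis inv_into_injective)
  qed
  moreover have "\<gamma> c \<in> S2 - K"
  proof -
    have False if "t \<in> {0..a} \<union> {b..1}" "\<gamma> c = \<gamma> t" for t
      using inj [of c t] abc that by auto
    then show ?thesis
      using S2 abc unfolding K_def path_image_def by fastforce
  qed
  then have "h ` (S2 - K) \<noteq> {}"
    by blast
  ultimately have "DIM(complex) \<le> DIM(real)"
    by (rule invariance_of_dimension [OF _ op])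
  then show False
    by simp
qed

section \<open>Components of the complement at a simple point\<close>

text \<open>The planar sides \<open>I\<close> and \<open>J\<close> are carried back to the sphere by
  \<open>k\<close>, and the components containing them are the two sought. The conclusion also
  records points with different winding numbers, because the covering argument needs this jump for a
  pole of its own choice; these points avoid \<open>e\<close>, where \<open>h\<close> has no
  meaning.\<close>

lemma sphere_components_at_simple_point:
  fixes \<gamma> :: "real \<Rightarrow> real ^ 3"
  assumes \<gamma>: "path \<gamma>" "pathfinish \<gamma> = pathstart \<gamma>" "path_image \<gamma> \<subseteq> S2 - {e}"
    and abc: "0 < a" "a < c" "c < b" "b < 1"
    and inj: "\<And>s t. \<lbrakk>s \<in> {a..b}; t \<in> {0..1}; \<gamma> s = \<gamma> t\<rbrakk> \<Longrightarrow> s = t"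
    and hk: "homeomorphism (S2 - {e}) (UNIV :: complex set) h k"
  obtains A B x y where "A \<noteq> B"
    "{C \<in> components (S2 - path_image \<gamma>). \<gamma> c \<in> closure C} = {A, B}"
    "x \<in> A - {e}" "y \<in> B - {e}"
    "winding_number (h \<circ> \<gamma>) (h x) \<noteq> winding_number (h \<circ> \<gamma>) (h y)"
proof -
  let ?X = "path_image \<gamma>"
  let ?comp = "connected_component_set (S2 - ?X)"
  have kh: "k (h x) = x" if "x \<in> S2 - {e}" for x
    using that by (rule homeomorphism_apply1 [OF hk])
  have hk_id: "h (k z) = z" for z
    by (rule homeomorphism_apply2 [OF hk]) simp
  have k_in: "k z \<in> S2 - {e}" for z
    using homeomorphism_image2 [OF hk] by blast
  have contk: "continuous_on S k" for S
    by (rule continuous_on_subset [OF homeomorphism_cont2 [OF hk]]) simp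
  have k\<gamma>: "k (h (\<gamma> t)) = \<gamma> t" if "t \<in> {0..1}" for t
    using that \<gamma>(3) unfolding path_image_def by (intro kh) blast
  have kX: "k z \<in> ?X \<longleftrightarrow> z \<in> path_image (h \<circ> \<gamma>)" for z
    unfolding path_image_compose using kh \<gamma>(3) hk_id by (metis image_iff subsetD)
  have inj': "s = t" if "s \<in> {a..b}" "t \<in> {0..1}" "(h \<circ> \<gamma>) s = (h \<circ> \<gamma>) t" for s t
  proof -
    have "s \<in> {0..1}"
      using that abc by auto
    moreover have "k (h (\<gamma> s)) = k (h (\<gamma> t))"
      using that by simp
    ultimately have "\<gamma> s = \<gamma> t"
      by (simp only: k\<gamma> that)
    then show ?thesis
      by (rule inj [OF that(1,2)])
  qed
  obtain N I J where N: "open N" "(h \<circ> \<gamma>) c \<in> N" and NIJ: "N - path_image (h \<circ> \<gamma>) = I \<union> J"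
    and cl: "(h \<circ> \<gamma>) c \<in> closure I" "(h \<circ> \<gamma>) c \<in> closure J"
    and conn: "\<And>x y. \<lbrakk>x \<in> I; y \<in> I\<rbrakk> \<Longrightarrow> connected_component (- path_image (h \<circ> \<gamma>)) x y"
      "\<And>x y. \<lbrakk>x \<in> J; y \<in> J\<rbrakk> \<Longrightarrow> connected_component (- path_image (h \<circ> \<gamma>)) x y"
    and wind: "\<And>x y. \<lbrakk>x \<in> I; y \<in> J\<rbrakk> \<Longrightarrow> winding_number (h \<circ> \<gamma>) x \<noteq> winding_number (h \<circ> \<gamma>) y"
    by (rule loop_winding_number_jump [OF path_stereographic [OF \<gamma> hk] abc inj']) blast+
  have ck: "k ((h \<circ> \<gamma>) c) = \<gamma> c"
    using k\<gamma> abc by simp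
  have cI: "\<gamma> c \<in> closure (k ` I)" and cJ: "\<gamma> c \<in> closure (k ` J)"
    using image_closure_subset [OF contk closed_closure closure_subset] cl ck
    by (metis image_eqI subsetD)+
  have transport: "connected_component (S2 - ?X) (k u) (k v)"
    if uv: "connected_component (- path_image (h \<circ> \<gamma>)) u v" for u v
  proof -
    obtain T where T: "connected T" "T \<subseteq> - path_image (h \<circ> \<gamma>)" "u \<in> T" "v \<in> T"
      using uv unfolding connected_component_def by blast
    have "connected (k ` T)"
      using T contk connected_continuous_image by blast
    moreover have "k ` T \<subseteq> S2 - ?X"
      using T(2) kX k_in by blast
    ultimately show ?thesis
      using T unfolding connected_component_def by blast
  qed
  have "I \<noteq> {}" "J \<noteq> {}"
    using cl by auto
  then obtain x y where xy: "x \<in> I" "y \<in> J"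
    by blast
  have ksub: "k z \<in> S2 - ?X" if "z \<in> I \<union> J" for z
    using that NIJ kX k_in by blast
  have subI: "k ` I \<subseteq> ?comp (k x)" and subJ: "k ` J \<subseteq> ?comp (k y)"
    using transport conn xy by auto
  have winding: "winding_number (h \<circ> \<gamma>) (h (k x)) \<noteq> winding_number (h \<circ> \<gamma>) (h (k y))"
    using wind xy by (simp add: hk_id)
  have op: "openin (top_of_set S2) (S2 - ?X)"
    using \<gamma>(1) by (simp add: Diff_eq openin_open_Int open_Compl closed_path_image)
  have comps: "?comp (k x) \<in> components (S2 - ?X)" "?comp (k y) \<in> components (S2 - ?X)"
    using ksub xy by (auto intro!: componentsI)
  have mem: "k x \<in> ?comp (k x) - {e}" "k y \<in> ?comp (k y) - {e}"
    using ksub xy k_in by auto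
  show ?thesis
  proof
    \<comment> \<open>A component is open, connected and off the curve, so a common component would
      force equal winding numbers.\<close>
    show "?comp (k x) \<noteq> ?comp (k y)"
    proof
      assume eq: "?comp (k x) = ?comp (k y)"
      have "openin (top_of_set S2) (?comp (k x))"
        using openin_components_locally_connected [OF locally_open_subset [OF locally_connected_sphere op] comps(1)]
          op openin_trans by blast
      moreover have "?comp (k x) \<inter> ?X = {}"
        using connected_component_subset [of "S2 - ?X"] by blast
      ultimately show False
        using winding_number_stereographic_eq [OF \<gamma> hk, of "?comp (k x)" "k x" "k y"] mem eq winding by simp
    qed
    show "{C \<in> components (S2 - ?X). \<gamma> c \<in> closure C} = {?comp (k x), ?comp (k y)}"
    proof
      show "{?comp (k x), ?comp (k y)} \<subseteq> {C \<in> components (S2 - ?X). \<gamma> c \<in> closure C}"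
        using comps cI cJ closure_mono [OF subI] closure_mono [OF subJ] by blast
      \<comment> \<open>There is no third component: the image of \<open>N\<close> is a
        neighbourhood of \<open>\<gamma> c\<close> in the sphere, so \<open>C\<close> meets it, and
        off the curve it consists of the images of \<open>I\<close> and \<open>J\<close>.\<close>
      show "{C \<in> components (S2 - ?X). \<gamma> c \<in> closure C} \<subseteq> {?comp (k x), ?comp (k y)}"
      proof
        fix C assume "C \<in> {C \<in> components (S2 - ?X). \<gamma> c \<in> closure C}"
        then have C: "C \<in> components (S2 - ?X)" "\<gamma> c \<in> closure C"
          by auto
        obtain T where T: "open T" "k ` N = S2 \<inter> T"
          using openin_inverse_stereographic_image [OF hk N(1)] unfolding openin_open by blast
        have "\<gamma> c \<in> T"
          using T N ck by (metis IntD2 image_eqI)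
        then obtain z where z: "z \<in> C" "z \<in> T"
          using C(2) T(1) unfolding closure_iff_nhds_not_empty by blast
        then have zX: "z \<in> S2 - ?X"
          using in_components_subset C(1) by blast
        then obtain w where w: "w \<in> N" "z = k w"
          using T(2) z by blast
        then have "w \<in> I \<union> J"
          using NIJ kX zX by blast
        then have "z \<in> ?comp (k x) \<or> z \<in> ?comp (k y)"
          using w subI subJ by blast
        then show "C \<in> {?comp (k x), ?comp (k y)}"
          using components_nonoverlap [OF C(1) comps(1)] components_nonoverlap [OF C(1) comps(2)] z by blast
      qed
    qed
  qed (use mem winding in auto)
qed

section \<open>A parametrisation of the circle\<close>

text \<open>Placing \<open>q\<close> at parameter 1/2 moves the base point to \<open>- q\<close>,
  the only point attained twice. Hence injectivity holds with \<open>s\<close> in the open interval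
  even when \<open>t\<close> is an endpoint.\<close>

lemma circle_loop_through:
  fixes q :: complex
  assumes "q \<in> S1"
  obtains c where "path c" "pathfinish c = pathstart c" "path_image c = S1" "c (1/2) = q"
    "\<And>s t. \<lbrakk>0 < s; s < 1; t \<in> {0..1}; c s = c t\<rbrakk> \<Longrightarrow> s = t"
proof -
  define c where "c t = q * exp (2 * of_real pi * \<i> * of_real (t - 1/2))" for t
  have q: "norm q = 1" "q \<noteq> 0"
    using assms by auto
  have cis: "c t = q * cis (2 * pi * (t - 1/2))" for t
    unfolding c_def cis_conv_exp by (simp add: mult_ac)
  show ?thesis
  proof
    show "path c"
      unfolding path_def c_def by (intro continuous_intros)
    show "pathfinish c = pathstart c"
      by (simp add: pathfinish_def pathstart_def cis cis.code)
    show "c (1/2) = q"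
      by (simp add: c_def)
    show "path_image c = S1"
    proof
      show "path_image c \<subseteq> S1"
        using q by (auto simp: path_image_def cis norm_mult)
      show "S1 \<subseteq> path_image c"
      proof
        fix x :: complex assume x: "x \<in> S1"
        define t where "t = 1/2 + Arg (x / q) / (2 * pi)"
        have "- pi < Arg (x / q)" "Arg (x / q) \<le> pi"
          using Arg_bounded by auto
        then have "t \<in> {0..1}"
          by (auto simp: t_def field_simps)
        moreover have "norm (x / q) = 1" "x / q \<noteq> 0"
          using x q by (auto simp: norm_divide)
        then have arg: "cis (Arg (x / q)) = x / q"
          by (metis cis_Arg div_by_1 of_real_1 sgn_eq)
        have "2 * pi * (t - 1/2) = Arg (x / q)"
          by (simp add: t_def)
        then have "c t = x"
          using q by (simp only: cis arg) simp
        ultimately show "x \<in> path_image c"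
          unfolding path_image_def by blast
      qed
    qed
    show "s = t" if st: "0 < s" "s < 1" "t \<in> {0..1}" "c s = c t" for s t
    proof -
      have "cis (2 * pi * (s - 1/2)) = cis (2 * pi * (t - 1/2))"
        using st q by (simp add: cis)
      then obtain n :: int where "\<i> * of_real (2 * pi * (s - 1/2)) =
          \<i> * of_real (2 * pi * (t - 1/2)) + (of_int (2 * n) * pi) * \<i>"
        unfolding cis_conv_exp exp_eq by blast
      then have "2 * pi * (s - 1/2) = 2 * pi * (t - 1/2) + 2 * n * pi"
        by (auto dest: arg_cong [where f = Im])
      then have "2 * pi * (s - t - n) = 0"
        by (simp add: algebra_simps)
      \<comment> \<open>The integer is 0 because \<open>s\<close> lies strictly inside the unit
        interval, so its distance to \<open>t\<close> is below 1.\<close>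
      then have "s - t = real_of_int n"
        by simp
      moreover from this have "\<bar>real_of_int n\<bar> < 1"
        using st by auto
      then have "n = 0"
        by linarith
      ultimately show ?thesis
        by simp
    qed
  qed
qed

section \<open>Separation, the two components and the covering property\<close>

theorem theorem2p1:
  fixes f :: "complex \<Rightarrow> real ^ 3" and U :: "complex set" and q :: complex and p :: "real ^ 3"
  assumes f_cont: "continuous_on S1 f"
    and f_into: "f \<in> S1 \<rightarrow> S2"
    and U_open: "openin (top_of_set S1) U"
    and U_inj: "U \<subseteq> injective_points f"
    and q_in: "q \<in> U"
    and p_eq: "p = f q"
  shows "\<not> connected (S2 - f ` S1)
    \<and> \<Union> (components (S2 - f ` S1)) = S2 - f ` S1
    \<and> disjoint (components (S2 - f ` S1))
    \<and> (\<forall>C \<in> components (S2 - f ` S1). openin (top_of_set S2) C)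
    \<and> (\<exists>U1 U2. U1 \<noteq> U2
        \<and> {C \<in> components (S2 - f ` S1). p \<in> top_of_set S2 closure_of C} = {U1, U2}
        \<and> (\<forall>F :: complex \<Rightarrow> real ^ 3.
              continuous_on D2 F \<and> F \<in> D2 \<rightarrow> S2 \<and> (\<forall>x \<in> S1. F x = f x)
              \<longrightarrow> U1 \<subseteq> F ` D2 \<or> U2 \<subseteq> F ` D2))"
proof -
  obtain T where T: "open T" "U = S1 \<inter> T"
    using U_open unfolding openin_open by blast
  have "q \<in> S1"
    using q_in T by blast
  then obtain c where c: "path c" "pathfinish c = pathstart c" "path_image c = S1" "c (1/2) = q"
    and c_inj: "\<And>s t. \<lbrakk>0 < s; s < 1; t \<in> {0..1}; c s = c t\<rbrakk> \<Longrightarrow> s = t"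
    using circle_loop_through by blast
  have c_S1: "c t \<in> S1" if "t \<in> {0..1}" for t
    using that c(3) unfolding path_image_def by blast
  define \<gamma> where "\<gamma> = f \<circ> c"
  have \<gamma>: "path \<gamma>" "pathfinish \<gamma> = pathstart \<gamma>" and im: "path_image \<gamma> = f ` S1" 
    and mid: "\<gamma> (1/2) = p"
    using c f_cont p_eq
    by (auto simp: \<gamma>_def path_continuous_image pathfinish_compose pathstart_compose path_image_compose)
  have X: "path_image \<gamma> \<subseteq> S2"
    using f_into by (auto simp: im)
  obtain d where "d > 0" and d: "\<And>t. \<lbrakk>t \<in> {0..1}; dist t (1/2) < d\<rbrakk> \<Longrightarrow> c t \<in> T"
  proof -
    have "continuous_on {0..1} c"
      using c(1) by (simp add: path_def)
    then obtain G where G: "open G" "G \<inter> {0..1} = c -` T \<inter> {0..1}"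
      using T(1) continuous_on_open_invariant by metis
    moreover have "1/2 \<in> G"
      using G(2) c(4) q_in T(2) by auto
    ultimately obtain d where d: "d > 0" "ball (1/2) d \<subseteq> G"
      using openE by blast
    show ?thesis
    proof (rule that [OF d(1)])
      fix t :: real assume "t \<in> {0..1}" "dist t (1/2) < d"
      then have "t \<in> G \<inter> {0..1}"
        using d(2) by (auto simp: dist_commute)
      then show "c t \<in> T"
        unfolding G(2) by blast
    qed
  qed
  \<comment> \<open>The half \<open>d / 2\<close> keeps the closed interval from \<open>a\<close> to
    \<open>b\<close> within distance \<open>d\<close> of 1/2, where \<open>c\<close> runs in
    \<open>U\<close>; the bound 1/4 keeps \<open>a\<close> and \<open>b\<close> strictly between 0
    and 1.\<close>
  define r where "r = min (d / 2) (1 / 4)"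
  define a b where "a = 1/2 - r" and "b = 1/2 + r"
  have r: "0 < r" "r < d" "r \<le> 1/4"
    using \<open>d > 0\<close> by (auto simp: r_def)
  then have abc: "0 < a" "a < 1/2" "1/2 < b" "b < 1"
    by (auto simp: a_def b_def)
  have inj: "s = t" if st: "s \<in> {a..b}" "t \<in> {0..1}" "\<gamma> s = \<gamma> t" for s t
  proof -
    have s: "s \<in> {0..1}" "0 < s" "s < 1"
      using st abc by auto
    moreover have "dist s (1/2) < d"
      using st r by (auto simp: dist_real_def a_def b_def)
    ultimately have "c s \<in> U"
      using d c_S1 T(2) by blast
    then have "S1 \<inter> f -` {f (c s)} = {c s}"
      using U_inj unfolding injective_points_def by blast
    moreover have "c t \<in> S1 \<inter> f -` {f (c s)}"
      using st c_S1 by (auto simp: \<gamma>_def)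
    ultimately have "c t \<in> {c s}"
      by (simp only:)
    then show ?thesis
      using c_inj [of s t] s st by simp
  qed
  let ?X = "f ` S1"
  let ?P = "{C \<in> components (S2 - ?X). p \<in> closure C}"
  \<comment> \<open>The pole is left free because it is chosen twice: first any point off the curve,
    to find the two components, then a point missed by the extension \<open>F\<close>.\<close>
  have sides: thesis if "e \<in> S2 - ?X" "homeomorphism (S2 - {e}) (UNIV :: complex set) h k"
      "\<And>A B x y. \<lbrakk>A \<noteq> B; ?P = {A, B}; x \<in> A - {e}; y \<in> B - {e};
        winding_number (h \<circ> \<gamma>) (h x) \<noteq> winding_number (h \<circ> \<gamma>) (h y)\<rbrakk> \<Longrightarrow> thesis"
    for thesis e h k
  proof -
    have "path_image \<gamma> \<subseteq> S2 - {e}"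
      using X im that(1) by blast
    then show thesis
      using sphere_components_at_simple_point [OF \<gamma> _ abc inj that(2)] that(3)
      unfolding im mid by blast
  qed
  obtain e where e: "e \<in> S2 - ?X"
    using simple_point_path_image_neq_sphere [OF \<gamma>(1) abc inj] X unfolding im by blast
  then obtain h k where "homeomorphism (S2 - {e}) (UNIV :: complex set) h k"
    using stereographic_projection by blast
  then obtain A B where AB: "A \<noteq> B" "?P = {A, B}"
    by (rule sides [OF e]) blast
  have op: "openin (top_of_set S2) (S2 - ?X)"
    using \<gamma>(1) by (simp add: Diff_eq openin_open_Int open_Compl closed_path_image im [symmetric])
  have openC: "openin (top_of_set S2) C" if "C \<in> components (S2 - ?X)" for C
    using openin_components_locally_connected [OF locally_open_subset [OF locally_connected_sphere op] that]
      op openin_trans by blast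
  \<comment> \<open>The sphere is closed in the ambient space, so the relative closure agrees with
    the ordinary one.\<close>
  have closure: "top_of_set S2 closure_of C = closure C" if "C \<in> components (S2 - ?X)" for C
  proof -
    have "C \<subseteq> S2"
      using in_components_subset [OF that] by blast
    moreover from this have "closure C \<subseteq> S2"
      by (simp add: closure_minimal)
    ultimately show ?thesis
      by (simp add: closure_of_subtopology Int_absorb1 Int_absorb2)
  qed
  have cover: "A \<subseteq> F ` D2 \<or> B \<subseteq> F ` D2"
    if F: "continuous_on D2 F" "F \<in> D2 \<rightarrow> S2" "\<forall>x \<in> S1. F x = f x" for F :: "complex \<Rightarrow> real ^ 3"
  proof (rule ccontr)
    assume "\<not> ?thesis"
    then obtain u v where u: "u \<in> A" "u \<notin> F ` D2" and v: "v \<in> B" "v \<notin> F ` D2"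
      by blast
    have AB_comp: "A \<in> components (S2 - ?X)" "B \<in> components (S2 - ?X)"
      using AB(2) by blast+
    then have disj: "A \<inter> B = {}" and sub: "A \<subseteq> S2 - ?X" "B \<subseteq> S2 - ?X"
      using AB(1) by (simp_all add: components_nonoverlap in_components_subset)
    then have uS2: "u \<in> S2 - ?X" and vS2: "v \<in> S2" "v \<noteq> u"
      using u v by blast+
    then have \<gamma>u: "path_image \<gamma> \<subseteq> S2 - {u}"
      using X im by blast
    obtain h k where hk: "homeomorphism (S2 - {u}) (UNIV :: complex set) h k"
      using stereographic_projection uS2 by blast
    obtain A' B' x' y' where A'B': "A' \<noteq> B'" "?P = {A', B'}" "x' \<in> A' - {u}" "y' \<in> B' - {u}"
      "winding_number (h \<circ> \<gamma>) (h x') \<noteq> winding_number (h \<circ> \<gamma>) (h y')"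
      by (rule sides [OF uS2 hk]) blast
    \<comment> \<open>The pole \<open>u\<close> may yield the two components in the other order; the
      inequality of winding numbers is symmetric, so they can be renamed.\<close>
    then have "A' = A \<and> B' = B \<or> A' = B \<and> B' = A"
      using AB by (metis doubleton_eq_iff)
    then obtain x y where xy: "x \<in> A - {u}" "y \<in> B - {u}"
      "winding_number (h \<circ> \<gamma>) (h x) \<noteq> winding_number (h \<circ> \<gamma>) (h y)"
    proof (elim disjE conjE)
      assume "A' = A" "B' = B"
      then show thesis
        using that [of x' y'] A'B'(3-5) by simp
    next
      assume "A' = B" "B' = A"
      then show thesis
        using that [of y' x'] A'B'(3-5) by simp
    qed
    \<comment> \<open>The pole \<open>u\<close> lies in \<open>A\<close>, so \<open>A\<close> is the
      side containing the point at infinity.\<close>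
    have eq_0: "winding_number (h \<circ> \<gamma>) (h x) = 0"
      using AB_comp sub im openC in_components_connected u xy(1)
      by (intro winding_number_stereographic_eq_0 [OF \<gamma> \<gamma>u hk, of A]) auto
    \<comment> \<open>On the side \<open>B\<close> the value may be read off at the other missed
      point \<open>v\<close>. There \<open>\<gamma>\<close> is the boundary loop of
      \<open>F\<close>, which contracts away from both \<open>u\<close> and
      \<open>v\<close>.\<close>
    have "winding_number (h \<circ> \<gamma>) (h y) = winding_number (h \<circ> \<gamma>) (h v)"
      using AB_comp sub im openC in_components_connected v vS2 xy(2)
      by (intro winding_number_stereographic_eq [OF \<gamma> \<gamma>u hk, of B]) auto
    also have "winding_number (h \<circ> \<gamma>) (h v) = winding_number (h \<circ> (F \<circ> c)) (h v)"
      using F(3) c_S1 by (intro winding_number_cong) (simp add: \<gamma>_def)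
    also have "\<dots> = 0"
    proof (rule winding_number_stereographic_disc [OF hk F(1)])
      show "F \<in> D2 \<rightarrow> S2 - {u, v}"
        using F(2) u v by blast
      show "path_image c \<subseteq> D2"
        using c(3) sphere_cball by blast
    qed (use c vS2 in auto)
    finally show False
      using eq_0 xy(3) by simp
  qed
  have "\<exists>U1 U2. U1 \<noteq> U2
      \<and> {C \<in> components (S2 - ?X). p \<in> top_of_set S2 closure_of C} = {U1, U2}
      \<and> (\<forall>F :: complex \<Rightarrow> real ^ 3.
            continuous_on D2 F \<and> F \<in> D2 \<rightarrow> S2 \<and> (\<forall>x \<in> S1. F x = f x)
            \<longrightarrow> U1 \<subseteq> F ` D2 \<or> U2 \<subseteq> F ` D2)"
  proof (intro exI conjI allI impI; (elim conjE)?)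
    show "A \<noteq> B"
      by (rule AB(1))
    show "{C \<in> components (S2 - ?X). p \<in> top_of_set S2 closure_of C} = {A, B}"
      using closure AB(2) by auto
  qed (rule cover)
  moreover have "\<not> connected (S2 - ?X)"
  proof
    assume "connected (S2 - ?X)"
    then have "components (S2 - ?X) = {S2 - ?X}"
      using components_eq_sing_iff [of "S2 - ?X"] e by blast
    moreover have "A \<in> components (S2 - ?X)" "B \<in> components (S2 - ?X)"
      using AB(2) by blast+
    ultimately show False
      using AB(1) by simp
  qed
  moreover have "disjoint (components (S2 - ?X))"
    using components_nonoverlap by (intro disjointI) blast
  moreover have "\<Union> (components (S2 - ?X)) = S2 - ?X"
    by (rule Union_components)
  ultimately show ?thesis
    using openC by (intro conjI ballI) assumption+
qed

end
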